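(* Let $\mathcal{H}_X$ and $\mathcal{H}_B$ be finite-dimensional complex Hilbert spaces, let $\{|x\rangle\}_x$ be an orthonormal basis of $\mathcal{H}_X$, let $(p_x)_x$ be a probability distribution, let $\rho_B^x$ be a density operator on $\mathcal{H}_B$ for each $x$, and let $$\rho_{XB}=\sum_x p_x\,|x\rangle\langle x|\otimes\rho_B^x .$$ Then $$H_{\min}(X|B)_\rho=-\log_2 p_{\mathsf{guess}}(X|B)_\rho ,$$ where $$p_{\mathsf{guess}}(X|B)_\rho:=\max_{\{E_B^x\}_x}\sum_x p_x\,\mathrm{tr}(E_B^x\rho_B^x),$$ the maximum being over all POVMs $\{E_B^x\}_x$ on $\mathcal{H}_B$, i.e. families of nonnegative operators indexed by $x$ with $\sum_x E_B^x=\mathrm{id}_B$.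
   Context: A density operator is a nonnegative (positive semidefinite) operator of trace one; $\mathrm{id}_A$ denotes the identity on system $A$. For nonnegative operators $\tau,\tau'$ define $D_\infty(\tau\|\tau'):=\inf\{\lambda\in\mathbb{R}:\ \tau\le 2^\lambda\tau'\}$, where $\le$ is the order on Hermitian operators and $\inf\emptyset=+\infty$. For a density operator $\rho_{AB}$ on $\mathcal{H}_A\otimes\mathcal{H}_B$, the conditional min-entropy is $$H_{\min}(A|B)_\rho:=-\inf_{\sigma_B}D_\infty(\rho_{AB}\|\mathrm{id}_A\otimes\sigma_B),$$ where the infimum ranges over all (normalized) density operators $\sigma_B$ on $\mathcal{H}_B$. Here it is applied with $A=X$. *)

theory Defs
  imports "HOL-Analysis.Analysis"
begin

text \<open>
  Finite-dimensional Hilbert spaces are coordinatised as \<open>complex ^ 'n\<close>, operators are complex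
  matrices acting by \<open>(*v)\<close>, and the tensor product of the spaces with index types \<open>'a\<close> and \<open>'b\<close>
  is the space with index type \<open>'a \<times> 'b\<close>.
\<close>

definition cinner :: "complex ^ 'n \<Rightarrow> complex ^ 'n \<Rightarrow> complex"
  where "cinner u v = (\<Sum>i\<in>UNIV. cnj (u $ i) * v $ i)"

definition orthonormal_basis :: "('x \<Rightarrow> complex ^ 'n) \<Rightarrow> bool"
  where "orthonormal_basis e \<longleftrightarrow>
    (\<forall>x y. cinner (e x) (e y) = (if x = y then 1 else 0)) \<and> vec.span (range e) = UNIV"

definition hermitian :: "complex ^ 'n ^ 'n \<Rightarrow> bool"
  where "hermitian A \<longleftrightarrow> (\<forall>i j. A $ j $ i = cnj (A $ i $ j))"

definition nonneg_op :: "complex ^ 'n ^ 'n \<Rightarrow> bool"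
  where "nonneg_op A \<longleftrightarrow> hermitian A \<and> (\<forall>v. 0 \<le> Re (cinner v (A *v v)))"

definition op_le :: "complex ^ 'n ^ 'n \<Rightarrow> complex ^ 'n ^ 'n \<Rightarrow> bool"
  where "op_le A B \<longleftrightarrow> hermitian A \<and> hermitian B \<and> nonneg_op (B - A)"

definition density_op :: "complex ^ 'n ^ 'n \<Rightarrow> bool"
  where "density_op \<rho> \<longleftrightarrow> nonneg_op \<rho> \<and> trace \<rho> = 1"

definition rank_one_op :: "complex ^ 'n \<Rightarrow> complex ^ 'n ^ 'n"
  where "rank_one_op u = (\<chi> i j. u $ i * cnj (u $ j))"

definition tensor_op ::
    "complex ^ 'a::finite ^ 'a \<Rightarrow> complex ^ 'b::finite ^ 'b \<Rightarrow> complex ^ ('a \<times> 'b) ^ ('a \<times> 'b)"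
  where "tensor_op A B = (\<chi> i j. A $ fst i $ fst j * B $ snd i $ snd j)"

text \<open>In \<open>ereal\<close> the infimum of the empty set is \<open>\<infinity>\<close>.\<close>

definition D_infty :: "complex ^ 'n ^ 'n \<Rightarrow> complex ^ 'n ^ 'n \<Rightarrow> ereal"
  where "D_infty \<tau> \<tau>' = Inf {ereal l | l. op_le \<tau> ((2 powr l) *\<^sub>R \<tau>')}"

definition H_min :: "complex ^ ('a::finite \<times> 'b::finite) ^ ('a \<times> 'b) \<Rightarrow> ereal"
  where "H_min \<rho> = - (INF \<sigma> \<in> {\<sigma> :: complex ^ 'b ^ 'b. density_op \<sigma>}.
    D_infty \<rho> (tensor_op (mat 1 :: complex ^ 'a ^ 'a) \<sigma>))"

definition cq_state ::
    "('x::finite \<Rightarrow> complex ^ 'n::finite) \<Rightarrow> ('x \<Rightarrow> real) \<Rightarrow> ('x \<Rightarrow> complex ^ 'b::finite ^ 'b) \<Rightarrow> complex ^ ('n \<times> 'b) ^ ('n \<times> 'b)"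
  where "cq_state e p \<rho> = (\<Sum>x\<in>UNIV. p x *\<^sub>R tensor_op (rank_one_op (e x)) (\<rho> x))"

definition povm :: "('x::finite \<Rightarrow> complex ^ 'b ^ 'b) \<Rightarrow> bool"
  where "povm E \<longleftrightarrow> (\<forall>x. nonneg_op (E x)) \<and> (\<Sum>x\<in>UNIV. E x) = mat 1"

text \<open>The trace of a product of two nonnegative operators is real, so \<open>Re\<close> discards nothing.\<close>

definition success_prob ::
    "('x::finite \<Rightarrow> real) \<Rightarrow> ('x \<Rightarrow> complex ^ 'b ^ 'b) \<Rightarrow> ('x \<Rightarrow> complex ^ 'b ^ 'b) \<Rightarrow> real"
  where "success_prob p \<rho> E = (\<Sum>x\<in>UNIV. p x * Re (trace (E x ** \<rho> x)))"

definition p_guess :: "('x::finite \<Rightarrow> real) \<Rightarrow> ('x \<Rightarrow> complex ^ 'b ^ 'b) \<Rightarrow> real"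
  where "p_guess p \<rho> = (GREATEST g. g \<in> {success_prob p \<rho> E | E. povm E})"

text \<open>The maximum in \<open>p_guess\<close> exists, because the POVMs form a nonempty compact set.\<close>

lemma hermitian_nonneg_entry_bound:
  fixes A :: "complex ^ 'n ^ 'n"
  assumes "nonneg_op A"
  shows "0 \<le> Re (A $ i $ i)"
    and "i \<noteq> j \<Longrightarrow> 2 * \<bar>Re (A $ i $ j)\<bar> \<le> Re (A $ i $ i) + Re (A $ j $ j)"
    and "i \<noteq> j \<Longrightarrow> 2 * \<bar>Im (A $ i $ j)\<bar> \<le> Re (A $ i $ i) + Re (A $ j $ j)"
proof -
  have h: "A $ l $ k = cnj (A $ k $ l)" for k l
    using assms unfolding nonneg_op_def hermitian_def by blast
  have nn: "0 \<le> Re (cinner v (A *v v))" for v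
    using assms unfolding nonneg_op_def by blast
  have mv: "(A *v axis k c) $ l = A $ l $ k * c" for k l c
    by (simp add: matrix_vector_mult_def axis_def if_distrib cong: if_cong)
  have ci: "cinner (axis k c) w = cnj c * w $ k" for k c w
    by (simp add: cinner_def axis_def if_distrib if_distribR cong: if_cong)
  have cadd: "cinner (u + v) w = cinner u w + cinner v w" for u v w :: "complex ^ 'n"
    by (simp add: cinner_def algebra_simps sum.distrib)
  have q: "cinner (axis i 1 + axis j c) (A *v (axis i 1 + axis j c)) =
      A $ i $ i + A $ i $ j * c + cnj c * (A $ j $ i + A $ j $ j * c)" for j c
    by (simp add: cadd ci matrix_vector_right_distrib mv)
  show d: "0 \<le> Re (A $ i $ i)"
    using nn[of "axis i 1"] by (simp add: ci mv)
  {
    assume "i \<noteq> j"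
    have a: "Re (A $ j $ i) = Re (A $ i $ j)" "Im (A $ j $ i) = - Im (A $ i $ j)"
      using h[of j i] by auto
    show "2 * \<bar>Re (A $ i $ j)\<bar> \<le> Re (A $ i $ i) + Re (A $ j $ j)"
      using nn[of "axis i 1 + axis j 1"] nn[of "axis i 1 + axis j (-1)"]
      unfolding q by (simp add: a)
    show "2 * \<bar>Im (A $ i $ j)\<bar> \<le> Re (A $ i $ i) + Re (A $ j $ j)"
      using nn[of "axis i 1 + axis j \<i>"] nn[of "axis i 1 + axis j (-\<i>)"]
      unfolding q by (simp add: a)
  }
qed

lemma povm_norm_bound:
  fixes E :: "'x::finite \<Rightarrow> complex ^ 'b ^ 'b"
  assumes "povm E"
  shows "norm (E x $ i $ j) \<le> 2"
proof -
  have nn: "nonneg_op (E x)" for x using assms by (simp add: povm_def)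
  have diag: "Re (E x $ k $ k) \<le> 1" for k
  proof -
    have "(\<Sum>x\<in>UNIV. E x) $ k $ k = 1" using assms by (simp add: povm_def mat_def)
    then have "(\<Sum>x\<in>UNIV. Re (E x $ k $ k)) = 1"
      by (simp flip: Re_sum)
    moreover have "Re (E x $ k $ k) \<le> (\<Sum>x\<in>UNIV. Re (E x $ k $ k))"
      using hermitian_nonneg_entry_bound(1)[OF nn] by (intro member_le_sum) auto
    ultimately show ?thesis by simp
  qed
  show ?thesis
  proof (cases "i = j")
    case True
    have "Im (E x $ i $ i) = 0"
      using nn[of x] by (metis Reals_cnj_iff complex_is_Real_iff hermitian_def nonneg_op_def)
    then show ?thesis
      using True diag[of i] hermitian_nonneg_entry_bound(1)[OF nn, of x i]
        cmod_le[of "E x $ i $ i"] by auto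
  next
    case False
    then show ?thesis
      using diag[of i] diag[of j] hermitian_nonneg_entry_bound(2,3)[OF nn False, of x]
        cmod_le[of "E x $ i $ j"] by linarith
  qed
qed

lemma p_guess_is_max:
  fixes p :: "'x::finite \<Rightarrow> real" and \<rho> :: "'x \<Rightarrow> complex ^ 'b ^ 'b"
  shows "\<exists>E. povm E \<and> success_prob p \<rho> E = p_guess p \<rho>"
    and "povm E \<Longrightarrow> success_prob p \<rho> E \<le> p_guess p \<rho>"
proof -
  define S where "S = {F :: complex ^ 'b ^ 'b ^ 'x. povm (($) F)}"
  have "bounded S"
  proof (rule boundedI)
    fix F assume "F \<in> S"
    then have b: "norm (F $ x $ i $ j) \<le> 2" for x i j
      unfolding S_def using povm_norm_bound by fastforce
    have "norm F \<le> (\<Sum>x\<in>UNIV. norm (F $ x))" by (simp add: norm_vec_def L2_set_le_sum)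
    also have "\<dots> \<le> (\<Sum>x\<in>(UNIV::'x set). \<Sum>i\<in>(UNIV::'b set). norm (F $ x $ i))"
      by (intro sum_mono) (simp add: norm_vec_def L2_set_le_sum)
    also have "\<dots> \<le> (\<Sum>x\<in>(UNIV::'x set). \<Sum>i\<in>(UNIV::'b set). \<Sum>j\<in>(UNIV::'b set). norm (F $ x $ i $ j))"
      by (intro sum_mono) (simp add: norm_vec_def L2_set_le_sum)
    also have "\<dots> \<le> (\<Sum>x\<in>(UNIV::'x set). \<Sum>i\<in>(UNIV::'b set). \<Sum>j\<in>(UNIV::'b set). 2)"
      by (intro sum_mono b)
    finally show "norm F \<le> (\<Sum>x\<in>(UNIV::'x set). \<Sum>i\<in>(UNIV::'b set). \<Sum>j\<in>(UNIV::'b set). 2)" .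
  qed
  moreover have "closed S"
    unfolding S_def povm_def nonneg_op_def hermitian_def cinner_def matrix_vector_mult_def
    by (intro closed_Collect_conj closed_Collect_all closed_Collect_eq closed_Collect_le
        continuous_intros)
  ultimately have "compact S" by (simp add: compact_eq_bounded_closed)
  moreover have "S \<noteq> {}"
  proof -
    have "(\<chi> x. (1 / CARD('x)) *\<^sub>R mat 1) \<in> S"
    proof -
      have mv: "((c *\<^sub>R mat 1) *v v) $ i = of_real c * v $ i" for c i and v :: "complex ^ 'b"
        by (simp add: matrix_vector_mult_def mat_def scaleR_conv_of_real[where 'a = complex]
            if_distrib if_distribR cong: if_cong)
      have s: "cinner v ((c *\<^sub>R mat 1) *v v) = of_real (c * (norm v)\<^sup>2)" for c and v :: "complex ^ 'b"
      proof -
        have "cinner v ((c *\<^sub>R mat 1) *v v) = (\<Sum>i\<in>UNIV. of_real c * (v $ i * cnj (v $ i)))"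
          by (simp add: cinner_def mv mult_ac)
        also have "\<dots> = of_real (c * (norm v)\<^sup>2)"
          by (simp add: norm_vec_def L2_set_def sum_nonneg sum_distrib_left complex_norm_square[symmetric]
              del: of_real_power)
        finally show ?thesis .
      qed
      have "hermitian ((1 / CARD('x)) *\<^sub>R mat 1 :: complex ^ 'b ^ 'b)"
        by (simp add: hermitian_def mat_def)
      moreover have "(\<Sum>x\<in>(UNIV::'x set). (1 / CARD('x)) *\<^sub>R mat 1 :: complex ^ 'b ^ 'b) = mat 1"
        by (simp add: sum_constant_scaleR del: sum_constant)
      ultimately show ?thesis
        by (simp add: S_def povm_def nonneg_op_def s)
    qed
    then show ?thesis by auto
  qed
  moreover have "continuous_on S (\<lambda>F. success_prob p \<rho> (($) F))"
    unfolding success_prob_def trace_def matrix_matrix_mult_def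
    by (simp, intro continuous_intros)
  ultimately obtain F where F: "F \<in> S" "\<And>G. G \<in> S \<Longrightarrow> success_prob p \<rho> (($) G) \<le> success_prob p \<rho> (($) F)"
    by (metis continuous_attains_sup)
  have le: "success_prob p \<rho> E \<le> success_prob p \<rho> (($) F)" if "povm E" for E
  proof -
    have "($) (\<chi> x. E x) = E" by (simp add: fun_eq_iff)
    then show ?thesis using F(2)[of "\<chi> x. E x"] that by (simp only: S_def mem_Collect_eq)
  qed
  have eq: "p_guess p \<rho> = success_prob p \<rho> (($) F)"
    unfolding p_guess_def by (rule Greatest_equality) (use F(1) le S_def in auto)
  show "\<exists>E. povm E \<and> success_prob p \<rho> E = p_guess p \<rho>"
    using F(1) eq by (auto simp: S_def)
  show "povm E \<Longrightarrow> success_prob p \<rho> E \<le> p_guess p \<rho>"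
    using le eq by simp
qed

end

theory Submission
  imports Defs
begin

text \<open>
  Since \<open>\<rho>\<^sub>X\<^sub>B\<close> is block diagonal, \<open>\<rho>\<^sub>X\<^sub>B \<le> c id \<otimes> \<sigma>\<close> means \<open>p\<^sub>x \<rho>\<^sub>x \<le> c \<sigma>\<close> for all \<open>x\<close>, and pairing with
  a POVM gives \<open>p_guess \<le> c\<close>. Conversely, let \<open>g = p_guess\<close>. If no density operator \<open>\<sigma>\<close> satisfied
  \<open>p\<^sub>x \<rho>\<^sub>x \<le> g \<sigma>\<close> for all \<open>x\<close>, the compact convex set of families \<open>(g \<sigma> - p\<^sub>x \<rho>\<^sub>x)\<^sub>x\<close> could be separated
  from the closed cone of nonnegative families. The separating functional is a family \<open>F\<close> of
  nonnegative operators with \<open>\<Sum>\<^sub>x tr (F\<^sub>x p\<^sub>x \<rho>\<^sub>x) > g tr (S \<sigma>)\<close> for all \<open>\<sigma>\<close>, where \<open>S = \<Sum>\<^sub>x F\<^sub>x\<close>.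
  Dividing \<open>F\<close> by the largest eigenvalue of \<open>S\<close> and completing it to a POVM beats \<open>g\<close>.
\<close>

section \<open>Hermitian and nonnegative operators, Frobenius inner product\<close>

lemma nonneg_opD:
  assumes "nonneg_op A"
  shows "hermitian A" "0 \<le> Re (cinner v (A *v v))"
  using assms by (auto simp: nonneg_op_def)

lemma hermitianD: "hermitian A \<Longrightarrow> A $ j $ i = cnj (A $ i $ j)"
  unfolding hermitian_def by blast

text \<open>In this orientation the condition is a terminating rewrite rule.\<close>

lemma hermitian_iff: "hermitian A \<longleftrightarrow> (\<forall>i j. cnj (A $ i $ j) = A $ j $ i)"
  unfolding hermitian_def by metis

lemma hermitian_add: "hermitian A \<Longrightarrow> hermitian B \<Longrightarrow> hermitian (A + B)"
  by (simp add: hermitian_iff)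

lemma hermitian_diff: "hermitian A \<Longrightarrow> hermitian B \<Longrightarrow> hermitian (A - B)"
  by (simp add: hermitian_iff)

lemma hermitian_scaleR: "hermitian A \<Longrightarrow> hermitian (c *\<^sub>R A)"
  by (simp add: hermitian_iff)

lemma hermitian_sum: "(\<And>x. x \<in> I \<Longrightarrow> hermitian (A x)) \<Longrightarrow> hermitian (\<Sum>x\<in>I. A x)"
  by (simp add: hermitian_iff)

lemma hermitian_rank_one_op: "hermitian (rank_one_op u)"
  by (simp add: hermitian_iff rank_one_op_def mult.commute)

lemma hermitian_mat_1: "hermitian (mat 1)"
  by (simp add: hermitian_iff mat_def)

text \<open>The Frobenius inner product makes the quadratic form of an operator linear in the operator.\<close>

lemma Re_quadratic_form: "Re (cinner v (A *v v)) = A \<bullet> rank_one_op v"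
  by (simp add: cinner_def matrix_vector_mult_def rank_one_op_def inner_vec_def sum_distrib_left
      inner_complex_def algebra_simps)

lemma nonneg_op_iff: "nonneg_op A \<longleftrightarrow> hermitian A \<and> (\<forall>v. 0 \<le> A \<bullet> rank_one_op v)"
  by (simp add: nonneg_op_def Re_quadratic_form)

lemma nonneg_op_0: "nonneg_op 0"
  by (simp add: nonneg_op_iff hermitian_iff)

lemma nonneg_op_add: "nonneg_op A \<Longrightarrow> nonneg_op B \<Longrightarrow> nonneg_op (A + B)"
  by (simp add: nonneg_op_iff hermitian_add inner_add_left)

lemma nonneg_op_scaleR: "nonneg_op A \<Longrightarrow> 0 \<le> c \<Longrightarrow> nonneg_op (c *\<^sub>R A)"
  by (simp add: nonneg_op_iff hermitian_scaleR)

lemma nonneg_op_sum: "(\<And>x. x \<in> I \<Longrightarrow> nonneg_op (A x)) \<Longrightarrow> nonneg_op (\<Sum>x\<in>I. A x)"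
  by (simp add: nonneg_op_iff hermitian_sum inner_sum_left sum_nonneg)

lemma rank_one_op_mult: "rank_one_op u *v v = (\<chi> i. cinner u v * u $ i)"
  by (simp add: vec_eq_iff matrix_vector_mult_def rank_one_op_def cinner_def sum_distrib_left
      mult_ac)

lemma cinner_rank_one_op: "cinner v (rank_one_op u *v v) = of_real ((cmod (cinner u v))\<^sup>2)"
proof -
  have "cinner v (rank_one_op u *v v) = (\<Sum>i\<in>UNIV. u $ i * cnj (v $ i)) * cinner u v"
    unfolding rank_one_op_mult by (simp add: cinner_def[of v] sum_distrib_left mult_ac)
  also have "\<dots> = cnj (cinner u v) * cinner u v"
    by (simp add: cinner_def)
  finally have "cinner v (rank_one_op u *v v) = cnj (cinner u v) * cinner u v" .
  then show ?thesis
    by (metis complex_norm_square mult.commute)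
qed

lemma nonneg_rank_one_op: "nonneg_op (rank_one_op u)"
  by (simp add: nonneg_op_def hermitian_rank_one_op cinner_rank_one_op)

lemma trace_rank_one_op: "trace (rank_one_op v) = of_real ((norm v)\<^sup>2)"
  by (simp add: trace_def rank_one_op_def norm_vec_def L2_set_def sum_nonneg
      complex_norm_square[symmetric] del: of_real_power)

lemma inner_mat_1: "mat 1 \<bullet> (A :: complex ^ 'b ^ 'b) = Re (trace A)"
  by (simp add: trace_def inner_vec_def mat_def inner_complex_def if_distrib if_distribR
      cong: if_cong)

lemma nonneg_mat_1: "nonneg_op (mat 1)"
  by (simp add: nonneg_op_iff hermitian_mat_1 inner_mat_1 trace_rank_one_op)

text \<open>For Hermitian \<open>A\<close> transposing is entrywise conjugation, which turns the
  trace pairing into the real Frobenius inner product. All later duality arguments use the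
  latter.\<close>

lemma Re_trace_mult:
  assumes "hermitian A"
  shows "Re (trace (A ** B)) = A \<bullet> B"
proof -
  have "Re (trace (A ** B)) = (\<Sum>i\<in>UNIV. \<Sum>k\<in>UNIV. Re (A $ i $ k * B $ k $ i))"
    by (simp add: trace_def matrix_matrix_mult_def)
  also have "\<dots> = (\<Sum>k\<in>UNIV. \<Sum>i\<in>UNIV. Re (A $ i $ k * B $ k $ i))"
    by (rule sum.swap)
  also have "\<dots> = (\<Sum>k\<in>UNIV. \<Sum>i\<in>UNIV. A $ k $ i \<bullet> B $ k $ i)"
  proof (intro sum.cong refl)
    show "Re (A $ i $ k * B $ k $ i) = A $ k $ i \<bullet> B $ k $ i" for i k
      using hermitianD[OF assms, of k i] by (simp add: inner_complex_def)
  qed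
  finally show ?thesis by (simp add: inner_vec_def)
qed

section \<open>Positivity of the trace pairing\<close>

text \<open>Off-diagonal entries of a nonnegative operator are controlled by the diagonal. This is
  the base case of the elimination below.\<close>

lemma nonneg_op_eq_0:
  assumes "nonneg_op B" "\<And>i. Re (B $ i $ i) = 0"
  shows "B = 0"
proof -
  have "B $ i $ j = 0" for i j
  proof (cases "i = j")
    case True
    then show ?thesis
      using assms(2)[of i] hermitianD[OF nonneg_opD(1)[OF assms(1)], of i i]
      by (simp add: complex_eq_iff)
  next
    case False
    then show ?thesis
      using hermitian_nonneg_entry_bound(2,3)[OF assms(1) False] assms(2)
      by (simp add: complex_eq_iff)
  qed
  then show ?thesis by (simp add: vec_eq_iff)
qed

text \<open>One step of a Cholesky factorisation.\<close>

lemma nonneg_op_eliminate: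
  fixes B :: "complex ^ 'b ^ 'b"
  assumes "nonneg_op B" "Re (B $ k $ k) > 0"
  shows "nonneg_op (B - (1 / Re (B $ k $ k)) *\<^sub>R rank_one_op (column k B))" (is "nonneg_op ?B'")
proof -
  define d where "d = Re (B $ k $ k)"
  define u where "u = column k B"
  have h: "B $ j $ i = cnj (B $ i $ j)" for i j
    using hermitianD[OF nonneg_opD(1)[OF assms(1)]] .
  have Bkk: "B $ k $ k = of_real d"
    using h[of k k] by (simp add: complex_eq_iff d_def)
  have d0: "d > 0" using assms(2) by (simp add: d_def)
  have "0 \<le> ?B' \<bullet> rank_one_op v" for v
  proof -
    define c where "c = cinner u v"
    \<comment> \<open>Completing the square: this multiple of the \<open>k\<close>-th basis vector
      makes \<open>(B *v w) $ k\<close> vanish, and the form of \<open>B\<close> at \<open>w\<close>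
      equals the form of \<open>?B'\<close> at \<open>v\<close>.\<close>
    define w where "w = v - axis k (c / of_real d)"
    have Bax: "B *v axis k a = (\<chi> i. a * u $ i)" for a
      by (simp add: vec_eq_iff matrix_vector_mult_def axis_def u_def column_def if_distrib
          mult.commute cong: if_cong)
    have ci: "cinner (axis k a) x = cnj a * x $ k" for a x
      by (simp add: cinner_def axis_def if_distrib if_distribR cong: if_cong)
    have Bvk: "(B *v v) $ k = c"
      by (simp add: c_def cinner_def matrix_vector_mult_def u_def column_def h[of k, symmetric])
    have vu: "cinner v (\<chi> i. a * u $ i) = a * cnj c" for a
      by (simp add: c_def cinner_def sum_distrib_left mult_ac)
    have uk: "u $ k = of_real d" by (simp add: u_def column_def Bkk)
    have dl: "cinner (x - y) z = cinner x z - cinner y z" for x y z :: "complex ^ 'b"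
      by (simp add: cinner_def algebra_simps sum_subtractf)
    have dr: "cinner x (y - z) = cinner x y - cinner x z" for x y z :: "complex ^ 'b"
      by (simp add: cinner_def algebra_simps sum_subtractf)
    have "cinner w (B *v w) = cinner v (B *v v) - c / d * cnj c -
        (cnj (c / d) * c - cnj (c / d) * (c / d * d))"
      unfolding w_def matrix_vector_mult_diff_distrib dl dr Bax ci vu
      by (simp add: Bvk uk del: complex_cnj_divide)
    then have "cinner w (B *v w) = cinner v (B *v v) - c * cnj c / of_real d"
      using d0 by simp
    then have "Re (cinner w (B *v w)) = Re (cinner v (B *v v)) - (cmod c)\<^sup>2 / d"
      by (simp add: complex_norm_square[symmetric] flip: of_real_power of_real_divide)
    moreover have "rank_one_op u \<bullet> rank_one_op v = (cmod c)\<^sup>2"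
      by (simp add: Re_quadratic_form[symmetric] cinner_rank_one_op c_def)
    ultimately have "?B' \<bullet> rank_one_op v = Re (cinner w (B *v w))"
      by (simp add: inner_diff_left Re_quadratic_form d_def u_def)
    then show ?thesis using nonneg_opD(2)[OF assms(1)] by simp
  qed
  then show ?thesis
    using nonneg_opD(1)[OF assms(1)]
    by (simp add: nonneg_op_iff hermitian_diff hermitian_scaleR hermitian_rank_one_op)
qed

text \<open>Elimination writes \<open>B\<close> as a sum of nonnegative multiples of rank-one
  operators, and pairing \<open>A\<close> with a rank-one operator is a value of its quadratic form.
  Induction on the number of nonzero diagonal entries replaces the spectral theorem.\<close>

lemma inner_nonneg_op:
  assumes "nonneg_op A" "nonneg_op B"
  shows "0 \<le> A \<bullet> B"
  using assms(2)
proof (induction "card {i. Re (B $ i $ i) \<noteq> 0}" arbitrary: B rule: less_induct)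
  case less
  show ?case
  proof (cases "\<forall>i. Re (B $ i $ i) = 0")
    case True
    then show ?thesis using nonneg_op_eq_0[OF less.prems] by simp
  next
    case False
    then obtain k where k: "Re (B $ k $ k) \<noteq> 0" by auto
    then have pos: "Re (B $ k $ k) > 0"
      using hermitian_nonneg_entry_bound(1)[OF less.prems, of k] by linarith
    define B' where "B' = B - (1 / Re (B $ k $ k)) *\<^sub>R rank_one_op (column k B)"
    have B': "nonneg_op B'"
      unfolding B'_def by (rule nonneg_op_eliminate[OF less.prems pos])
    have diag: "Re (B' $ i $ i) = Re (B $ i $ i) - (cmod (B $ i $ k))\<^sup>2 / Re (B $ k $ k)" for i
      by (simp add: B'_def rank_one_op_def column_def complex_mult_cnj cmod_power2)
    have "Im (B $ k $ k) = 0"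
      using hermitianD[OF nonneg_opD(1)[OF less.prems], of k k] by (simp add: complex_eq_iff)
    then have k': "Re (B' $ k $ k) = 0"
      using k by (simp add: diag cmod_power2) (simp add: power2_eq_square)
    \<comment> \<open>The diagonal of \<open>B'\<close> lies between 0 and that of \<open>B\<close>,
      so zeros persist, and entry \<open>k\<close> is a new zero: the induction measure
      drops.\<close>
    have le: "Re (B' $ i $ i) \<le> Re (B $ i $ i)" for i
      using pos by (simp add: diag)
    have "Re (B $ i $ i) \<noteq> 0" if "Re (B' $ i $ i) \<noteq> 0" for i
      using that le[of i] hermitian_nonneg_entry_bound(1)[OF B', of i] by linarith
    then have "{i. Re (B' $ i $ i) \<noteq> 0} \<subset> {i. Re (B $ i $ i) \<noteq> 0}"
      using k k' by blast
    then have "0 \<le> A \<bullet> B'"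
      by (intro less.hyps B' psubset_card_mono) auto
    moreover have "0 \<le> A \<bullet> rank_one_op (column k B)"
      using assms(1) by (simp add: nonneg_op_iff)
    moreover have "B = B' + (1 / Re (B $ k $ k)) *\<^sub>R rank_one_op (column k B)"
      by (simp add: B'_def)
    ultimately show ?thesis
      using pos by (metis add_nonneg_nonneg divide_nonneg_pos inner_add_right inner_scaleR_right
          mult_nonneg_nonneg zero_le_one)
  qed
qed

section \<open>Classical-quantum states\<close>

text \<open>The sum fixes every basis vector, hence everything in their span. It resolves
  \<open>id \<otimes> \<sigma>\<close> into the same blocks as the classical-quantum state.\<close>

lemma orthonormal_basis_complete:
  fixes e :: "'x::finite \<Rightarrow> complex ^ 'n"
  assumes "orthonormal_basis e"
  shows "(\<Sum>x\<in>UNIV. rank_one_op (e x)) = mat 1"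
proof -
  have on: "cinner (e x) (e y) = (if x = y then 1 else 0)" for x y
    using assms by (simp add: orthonormal_basis_def)
  define S where "S = (\<Sum>x\<in>UNIV. rank_one_op (e x))"
  have mult_sum: "(\<Sum>x\<in>I. A x) *v v = (\<Sum>x\<in>I. A x *v v)"
    for A :: "'x \<Rightarrow> complex ^ 'n ^ 'n" and I v
    by (induction I rule: infinite_finite_induct) (simp_all add: matrix_vector_mult_add_rdistrib)
  have "S *v e y = e y" for y
    by (simp add: S_def mult_sum rank_one_op_mult on vec_eq_iff if_distrib if_distribR
        cong: if_cong)
  then have "S *v v = v" for v
  proof -
    have "v \<in> vec.span (range e)" using assms by (simp add: orthonormal_basis_def)
    then show ?thesis
    proof (induction rule: vec.span_induct_alt)
      case base
      then show ?case by simp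
    next
      case (step c x y)
      then show ?case
        using \<open>\<And>y. S *v e y = e y\<close>
        by (auto simp: matrix_vector_right_distrib matrix_vector_mult_scaleR vec.scale)
    qed
  qed
  then show ?thesis
    unfolding S_def[symmetric] by (simp add: matrix_eq)
qed

lemma hermitian_tensor_op: "hermitian A \<Longrightarrow> hermitian B \<Longrightarrow> hermitian (tensor_op A B)"
  by (simp add: hermitian_iff tensor_op_def)

lemma sum_UNIV_prod: "(\<Sum>i\<in>UNIV. f i) = (\<Sum>a\<in>UNIV. \<Sum>b\<in>UNIV. f (a, b))"
  by (simp add: sum.cartesian_product)

text \<open>The vector on the right is the partial contraction of \<open>w\<close> with
  \<open>u\<close> on the first factor. The sums are reordered until both contractions stand
  innermost.\<close>

lemma tensor_op_quadratic_form:
  "cinner w (tensor_op (rank_one_op u) B *v w) =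
    cinner (\<chi> b. \<Sum>a\<in>UNIV. cnj (u $ a) * w $ (a, b)) (B *v (\<chi> b. \<Sum>a\<in>UNIV. cnj (u $ a) * w $ (a, b)))"
proof -
  have "cinner w (tensor_op (rank_one_op u) B *v w) =
    (\<Sum>a\<in>UNIV. \<Sum>b\<in>UNIV. \<Sum>a'\<in>UNIV. \<Sum>b'\<in>UNIV.
      cnj (w $ (a, b)) * (u $ a * cnj (u $ a') * B $ b $ b' * w $ (a', b')))"
    by (simp add: cinner_def matrix_vector_mult_def tensor_op_def rank_one_op_def sum_UNIV_prod
        sum_distrib_left)
  also have "\<dots> = (\<Sum>b\<in>UNIV. \<Sum>a\<in>UNIV. \<Sum>b'\<in>UNIV. \<Sum>a'\<in>UNIV.
      cnj (w $ (a, b)) * (u $ a * cnj (u $ a') * B $ b $ b' * w $ (a', b')))"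
    by (subst sum.swap) (intro sum.cong refl sum.swap)
  also have "\<dots> = (\<Sum>b\<in>UNIV. \<Sum>b'\<in>UNIV. \<Sum>a\<in>UNIV. \<Sum>a'\<in>UNIV.
      cnj (w $ (a, b)) * (u $ a * cnj (u $ a') * B $ b $ b' * w $ (a', b')))"
    by (intro sum.cong refl sum.swap)
  also have "\<dots> = (\<Sum>b\<in>UNIV. \<Sum>b'\<in>UNIV. \<Sum>a'\<in>UNIV. \<Sum>a\<in>UNIV.
      cnj (w $ (a, b)) * (u $ a * cnj (u $ a') * B $ b $ b' * w $ (a', b')))"
    by (intro sum.cong refl sum.swap)
  also have "\<dots> = cinner (\<chi> b. \<Sum>a\<in>UNIV. cnj (u $ a) * w $ (a, b))
      (B *v (\<chi> b. \<Sum>a\<in>UNIV. cnj (u $ a) * w $ (a, b)))"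
    by (simp add: cinner_def matrix_vector_mult_def sum_distrib_left sum_distrib_right mult_ac)
  finally show ?thesis .
qed

lemma nonneg_tensor_rank_one_op:
  "nonneg_op B \<Longrightarrow> nonneg_op (tensor_op (rank_one_op u) B)"
  by (simp add: nonneg_op_def hermitian_tensor_op hermitian_rank_one_op tensor_op_quadratic_form)

text \<open>By completeness of \<open>e\<close>, the difference of the two operators is block
  diagonal with the operators on the right as its blocks. A sum of nonnegative blocks is
  nonnegative, and product vectors recover each block.\<close>

lemma cq_state_dominated_iff:
  fixes e :: "'x::finite \<Rightarrow> complex ^ 'n" and \<rho> :: "'x \<Rightarrow> complex ^ 'b ^ 'b"
  assumes e: "orthonormal_basis e" and \<rho>: "\<And>x. hermitian (\<rho> x)" and \<sigma>: "hermitian \<sigma>"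
  shows "op_le (cq_state e p \<rho>) (c *\<^sub>R tensor_op (mat 1 :: complex ^ 'n ^ 'n) \<sigma>) \<longleftrightarrow>
    (\<forall>x. nonneg_op (c *\<^sub>R \<sigma> - p x *\<^sub>R \<rho> x))"
proof -
  have t_sum: "tensor_op (\<Sum>x\<in>UNIV. A x) B = (\<Sum>x\<in>UNIV. tensor_op (A x) B)"
    for A :: "'x \<Rightarrow> complex ^ 'n ^ 'n" and B :: "complex ^ 'b ^ 'b"
    by (simp add: tensor_op_def vec_eq_iff sum_distrib_right)
  have t_diff: "c *\<^sub>R tensor_op A B - d *\<^sub>R tensor_op A B' = tensor_op A (c *\<^sub>R B - d *\<^sub>R B')"
    for A :: "complex ^ 'n ^ 'n" and B B' :: "complex ^ 'b ^ 'b" and d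
    by (simp add: tensor_op_def vec_eq_iff algebra_simps)
  have diff: "c *\<^sub>R tensor_op (mat 1 :: complex ^ 'n ^ 'n) \<sigma> - cq_state e p \<rho> =
      (\<Sum>x\<in>UNIV. tensor_op (rank_one_op (e x)) (c *\<^sub>R \<sigma> - p x *\<^sub>R \<rho> x))"
    by (simp add: cq_state_def orthonormal_basis_complete[OF e, symmetric] t_sum scaleR_sum_right
        t_diff sum_subtractf[symmetric])
  have herm: "hermitian (cq_state e p \<rho>)" "hermitian (c *\<^sub>R tensor_op (mat 1 :: complex ^ 'n ^ 'n) \<sigma>)"
    unfolding cq_state_def
    by (intro hermitian_sum hermitian_scaleR hermitian_tensor_op hermitian_rank_one_op
        hermitian_mat_1 \<rho> \<sigma>)+
  have "nonneg_op (c *\<^sub>R \<sigma> - p x *\<^sub>R \<rho> x)"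
    if n: "nonneg_op (\<Sum>x\<in>UNIV. tensor_op (rank_one_op (e x)) (c *\<^sub>R \<sigma> - p x *\<^sub>R \<rho> x))" for x
  proof -
    have "0 \<le> Re (cinner v ((c *\<^sub>R \<sigma> - p x *\<^sub>R \<rho> x) *v v))" for v
    proof -
      \<comment> \<open>The product vector of \<open>e x\<close> and \<open>v\<close>; by
        orthonormality its contraction with \<open>e y\<close> vanishes unless \<open>y = x\<close>,
        so only block \<open>x\<close> is tested.\<close>
      define w :: "complex ^ ('n \<times> 'b)" where "w = (\<chi> i. e x $ fst i * v $ snd i)"
      have contract: "(\<chi> b. \<Sum>a\<in>UNIV. cnj (e y $ a) * w $ (a, b)) = (if x = y then v else 0)" for y
      proof -
        have "(\<Sum>a\<in>UNIV. cnj (e y $ a) * w $ (a, b)) = cinner (e y) (e x) * v $ b" for b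
          by (simp add: w_def cinner_def sum_distrib_left mult_ac)
        then show ?thesis
          using e by (simp add: orthonormal_basis_def vec_eq_iff)
      qed
      have "0 \<le> (\<Sum>y\<in>UNIV. Re (cinner w (tensor_op (rank_one_op (e y)) (c *\<^sub>R \<sigma> - p y *\<^sub>R \<rho> y) *v w)))"
        using nonneg_opD(2)[OF n, of w] by (simp add: Re_quadratic_form inner_sum_left)
      also have "\<dots> = (\<Sum>y\<in>UNIV. if x = y then Re (cinner v ((c *\<^sub>R \<sigma> - p y *\<^sub>R \<rho> y) *v v)) else 0)"
        unfolding tensor_op_quadratic_form contract
        by (intro sum.cong) (auto simp: cinner_def)
      finally show ?thesis by simp
    qed
    then show ?thesis
      by (simp add: nonneg_op_def hermitian_diff hermitian_scaleR \<rho> \<sigma>)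
  qed
  then show ?thesis
    unfolding op_le_def diff using herm
    by (auto intro!: nonneg_op_sum nonneg_tensor_rank_one_op)
qed

section \<open>Duality\<close>

lemma density_op_nonempty: "\<exists>\<sigma> :: complex ^ 'b ^ 'b. density_op \<sigma>"
proof
  show "density_op (rank_one_op (axis undefined 1 :: complex ^ 'b))"
    by (simp add: density_op_def nonneg_rank_one_op trace_rank_one_op)
qed

text \<open>Unit trace bounds the diagonal, the diagonal bounds all entries, and the defining
  conditions are closed. Compactness gives both the strict separation and the maximiser
  \<open>\<sigma>0\<close> below.\<close>

lemma compact_density_op: "compact {\<sigma> :: complex ^ 'b ^ 'b. density_op \<sigma>}"
proof -
  have "norm \<sigma> \<le> (\<Sum>i\<in>(UNIV::'b set). \<Sum>j\<in>(UNIV::'b set). 2)"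
    if "density_op \<sigma>" for \<sigma> :: "complex ^ 'b ^ 'b"
  proof -
    have nn: "nonneg_op \<sigma>" and tr: "(\<Sum>i\<in>UNIV. Re (\<sigma> $ i $ i)) = 1"
      using that by (auto simp: density_op_def trace_def simp flip: Re_sum)
    note b = hermitian_nonneg_entry_bound[OF nn]
    have diag: "Re (\<sigma> $ i $ i) \<le> 1" for i
      using member_le_sum[of i UNIV "\<lambda>i. Re (\<sigma> $ i $ i)"] tr b(1) by simp
    have "norm (\<sigma> $ i $ j) \<le> 2" for i j
    proof (cases "i = j")
      case True
      then show ?thesis
        using diag[of i] b(1)[of i] hermitianD[OF nonneg_opD(1)[OF nn], of i i]
          cmod_le[of "\<sigma> $ i $ i"] by (simp add: complex_eq_iff)
    next
      case False
      then show ?thesis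
        using diag[of i] diag[of j] b(2,3)[OF False] cmod_le[of "\<sigma> $ i $ j"] by linarith
    qed
    moreover have "norm \<sigma> \<le> (\<Sum>i\<in>UNIV. norm (\<sigma> $ i))"
      by (simp add: norm_vec_def L2_set_le_sum)
    moreover have "(\<Sum>i\<in>UNIV. norm (\<sigma> $ i)) \<le> (\<Sum>i\<in>UNIV. \<Sum>j\<in>UNIV. norm (\<sigma> $ i $ j))"
      by (intro sum_mono) (simp add: norm_vec_def L2_set_le_sum)
    ultimately show ?thesis
      by (meson order_trans sum_mono)
  qed
  then have "bounded {\<sigma> :: complex ^ 'b ^ 'b. density_op \<sigma>}"
    by (intro boundedI) blast
  moreover have "closed {\<sigma> :: complex ^ 'b ^ 'b. density_op \<sigma>}"
    unfolding density_op_def nonneg_op_def hermitian_def cinner_def matrix_vector_mult_def trace_def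
    by (intro closed_Collect_conj closed_Collect_all closed_Collect_eq closed_Collect_le
        continuous_intros)
  ultimately show ?thesis by (simp add: compact_eq_bounded_closed)
qed

lemma convex_density_op: "convex {\<sigma> :: complex ^ 'b ^ 'b. density_op \<sigma>}"
  by (auto simp: convex_def density_op_def intro!: nonneg_op_add nonneg_op_scaleR)
    (simp add: trace_def sum.distrib flip: scaleR_sum_right scaleR_left_distrib)

lemma success_prob_inner:
  assumes "\<And>x. hermitian (E x)"
  shows "success_prob p \<rho> E = (\<Sum>x\<in>UNIV. E x \<bullet> (p x *\<^sub>R \<rho> x))"
  by (simp add: success_prob_def Re_trace_mult assms)

text \<open>Weak duality: pair the inequalities with an optimal POVM. Its elements sum to the
  identity, so the upper bound collapses to \<open>c\<close> times the trace of
  \<open>\<sigma>\<close>.\<close>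

lemma p_guess_le:
  fixes \<rho> :: "'x::finite \<Rightarrow> complex ^ 'b ^ 'b"
  assumes "\<And>x. nonneg_op (c *\<^sub>R \<sigma> - p x *\<^sub>R \<rho> x)" "trace \<sigma> = 1"
  shows "p_guess p \<rho> \<le> c"
proof -
  obtain E where E: "povm E" "success_prob p \<rho> E = p_guess p \<rho>"
    using p_guess_is_max(1) by blast
  then have nn: "\<And>x. nonneg_op (E x)" and sum: "(\<Sum>x\<in>UNIV. E x) = mat 1"
    by (auto simp: povm_def)
  have "p_guess p \<rho> = (\<Sum>x\<in>UNIV. E x \<bullet> (p x *\<^sub>R \<rho> x))"
    unfolding E(2)[symmetric] by (rule success_prob_inner) (rule nonneg_opD(1)[OF nn])
  also have "\<dots> \<le> (\<Sum>x\<in>UNIV. E x \<bullet> (c *\<^sub>R \<sigma>))"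
  proof (rule sum_mono)
    show "E x \<bullet> (p x *\<^sub>R \<rho> x) \<le> E x \<bullet> (c *\<^sub>R \<sigma>)" for x
      using inner_nonneg_op[OF nn assms(1), of x x] by (simp add: inner_diff_right)
  qed
  also have "\<dots> = c"
    unfolding inner_sum_left[symmetric] sum by (simp add: inner_mat_1 assms(2))
  finally show ?thesis .
qed

text \<open>The anti-Hermitian part of \<open>a\<close> is orthogonal to all Hermitian matrices. A
  separating functional, a priori an arbitrary matrix family, can thus be represented by Hermitian
  operators.\<close>

lemma hermitian_part:
  fixes a :: "complex ^ 'b ^ 'b"
  shows "\<exists>F. hermitian F \<and> (\<forall>B. hermitian B \<longrightarrow> F \<bullet> B = a \<bullet> B)"
proof (intro exI conjI allI impI)
  let ?F = "(1 / 2) *\<^sub>R (\<chi> i j. a $ i $ j + cnj (a $ j $ i))"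
  show "hermitian ?F" by (simp add: hermitian_iff add.commute)
  show "?F \<bullet> B = a \<bullet> B" if "hermitian B" for B
  proof -
    have "(\<chi> i j. cnj (a $ j $ i)) \<bullet> B = (\<Sum>i\<in>UNIV. \<Sum>j\<in>UNIV. a $ j $ i \<bullet> B $ j $ i)"
      unfolding inner_vec_def
    proof (intro sum.cong refl)
      show "(\<chi> i j. cnj (a $ j $ i)) $ i $ j \<bullet> B $ i $ j = a $ j $ i \<bullet> B $ j $ i" for i j
        using hermitianD[OF that, of i j] by (simp add: inner_complex_def)
    qed
    also have "\<dots> = a \<bullet> B" unfolding inner_vec_def by (rule sum.swap)
    finally have "(\<chi> i j. cnj (a $ j $ i)) \<bullet> B = a \<bullet> B" .
    moreover have "(\<chi> i j. a $ i $ j + cnj (a $ j $ i)) = a + (\<chi> i j. cnj (a $ j $ i))"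
      by (simp add: vec_eq_iff)
    ultimately show ?thesis by (simp add: inner_add_left)
  qed
qed

text \<open>If \<open>\<nu>\<close> bounds the largest eigenvalue of \<open>\<Sum>x. F x\<close>, then \<open>F / \<nu>\<close> can be completed to a POVM.\<close>

lemma subnormalised_success_le:
  fixes \<rho> :: "'x::finite \<Rightarrow> complex ^ 'b ^ 'b"
  assumes nn: "\<And>x. nonneg_op (F x)" and \<nu>: "\<nu> > 0" "nonneg_op (\<nu> *\<^sub>R mat 1 - (\<Sum>x\<in>UNIV. F x))"
    and R: "\<And>x. nonneg_op (p x *\<^sub>R \<rho> x)"
  shows "(\<Sum>x\<in>UNIV. F x \<bullet> (p x *\<^sub>R \<rho> x)) \<le> p_guess p \<rho> * \<nu>"
proof -
  \<comment> \<open>An arbitrary outcome, to which the missing part \<open>G\<close> of the identity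
    is assigned; as \<open>G\<close> is nonnegative, this cannot lower the success
    probability.\<close>
  define x0 where "x0 = (undefined :: 'x)"
  define G where "G = mat 1 - (1 / \<nu>) *\<^sub>R (\<Sum>x\<in>UNIV. F x)"
  define E where "E x = (1 / \<nu>) *\<^sub>R F x + (if x = x0 then G else 0)" for x
  have "G = (1 / \<nu>) *\<^sub>R (\<nu> *\<^sub>R mat 1 - (\<Sum>x\<in>UNIV. F x))"
    using \<nu>(1) by (simp add: G_def scaleR_diff_right)
  then have G: "nonneg_op G"
    using nonneg_op_scaleR[OF \<nu>(2), of "1 / \<nu>"] \<nu>(1) by simp
  have nnE: "nonneg_op (E x)" for x
    using \<nu>(1) by (auto simp: E_def intro!: nonneg_op_add nonneg_op_scaleR nn G nonneg_op_0)
  have "(\<Sum>x\<in>UNIV. E x) = (1 / \<nu>) *\<^sub>R (\<Sum>x\<in>UNIV. F x) + G"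
    by (simp add: E_def sum.distrib scaleR_sum_right)
  then have "povm E"
    by (simp add: povm_def nnE G_def)
  then have "success_prob p \<rho> E \<le> p_guess p \<rho>"
    by (rule p_guess_is_max(2))
  moreover have "(\<Sum>x\<in>UNIV. (1 / \<nu>) * (F x \<bullet> (p x *\<^sub>R \<rho> x))) \<le> success_prob p \<rho> E"
    unfolding success_prob_inner[OF nonneg_opD(1)[OF nnE]]
  proof (rule sum_mono)
    show "(1 / \<nu>) * (F x \<bullet> (p x *\<^sub>R \<rho> x)) \<le> E x \<bullet> (p x *\<^sub>R \<rho> x)" for x
      using inner_nonneg_op[OF G R, of x] by (auto simp: E_def inner_add_left algebra_simps)
  qed
  ultimately have "(1 / \<nu>) * (\<Sum>x\<in>UNIV. F x \<bullet> (p x *\<^sub>R \<rho> x)) \<le> p_guess p \<rho>"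
    by (simp only: sum_distrib_left[symmetric])
  then show ?thesis using \<nu>(1) by (simp add: field_simps)
qed

text \<open>Strong duality with attainment: strict separation from a compact set yields a single
  \<open>\<sigma>\<close> at the value \<open>p_guess\<close> itself, not merely at values above
  it.\<close>

lemma dominating_density_op:
  fixes \<rho> :: "'x::finite \<Rightarrow> complex ^ 'b ^ 'b"
  assumes R: "\<And>x. nonneg_op (p x *\<^sub>R \<rho> x)"
  shows "\<exists>\<sigma>. density_op \<sigma> \<and> (\<forall>x. nonneg_op (p_guess p \<rho> *\<^sub>R \<sigma> - p x *\<^sub>R \<rho> x))"
proof (rule ccontr)
  assume none: "\<not> ?thesis"
  define g where "g = p_guess p \<rho>"
  define D where "D = {\<sigma> :: complex ^ 'b ^ 'b. density_op \<sigma>}"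
  define f where "f \<sigma> = (\<chi> x. g *\<^sub>R \<sigma> - p x *\<^sub>R \<rho> x)" for \<sigma> :: "complex ^ 'b ^ 'b"
  define C where "C = {M :: complex ^ 'b ^ 'b ^ 'x. \<forall>x. nonneg_op (M $ x)}"
  have D: "compact D" "convex D" "D \<noteq> {}"
    using compact_density_op convex_density_op density_op_nonempty by (auto simp: D_def)
  \<comment> \<open>A translate of a linear image, from which convexity is inherited.\<close>
  have f_eq: "f ` D = (\<lambda>M. - (\<chi> x. p x *\<^sub>R \<rho> x) + M) ` (\<lambda>\<sigma>. \<chi> x. g *\<^sub>R \<sigma>) ` D"
    by (auto simp: f_def image_image vec_eq_iff intro!: image_cong)
  have "linear (\<lambda>\<sigma> :: complex ^ 'b ^ 'b. (\<chi> x. g *\<^sub>R \<sigma>) :: complex ^ 'b ^ 'b ^ 'x)"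
    by (rule linearI) (simp_all add: vec_eq_iff algebra_simps)
  then have "convex (f ` D)"
    unfolding f_eq by (intro convex_translation convex_linear_image D)
  moreover have "compact (f ` D)"
    unfolding f_def by (intro compact_continuous_image D continuous_intros)
  moreover have "convex C"
    by (auto simp: C_def convex_def intro!: nonneg_op_add nonneg_op_scaleR)
  moreover have "closed C"
    unfolding C_def nonneg_op_def hermitian_def cinner_def matrix_vector_mult_def
    by (intro closed_Collect_conj closed_Collect_all closed_Collect_eq closed_Collect_le
        continuous_intros)
  moreover have "f ` D \<inter> C = {}"
    using none by (auto simp: C_def D_def f_def g_def)
  moreover have "f ` D \<noteq> {}"
    using D by simp
  ultimately obtain a b where ab: "\<And>\<sigma>. \<sigma> \<in> D \<Longrightarrow> a \<bullet> f \<sigma> < b" "\<And>M. M \<in> C \<Longrightarrow> b < a \<bullet> M"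
    using separating_hyperplane_compact_closed[of "f ` D" C] by blast
  have b0: "b < 0"
    using ab(2)[of 0] by (simp add: C_def nonneg_op_0)
  \<comment> \<open>\<open>C\<close> is a cone: a member with negative value could be rescaled to
    have value exactly \<open>b\<close>, against the strict bound.\<close>
  have aC: "0 \<le> a \<bullet> M" if "M \<in> C" for M
  proof (rule ccontr)
    assume neg: "\<not> 0 \<le> a \<bullet> M"
    have "(b / (a \<bullet> M)) *\<^sub>R M \<in> C"
      using that b0 neg by (auto simp: C_def intro!: nonneg_op_scaleR divide_nonpos_nonpos)
    then show False using ab(2) neg by fastforce
  qed
  obtain F where F: "\<And>x. hermitian (F x)" "\<And>x B. hermitian B \<Longrightarrow> F x \<bullet> B = a $ x \<bullet> B"
    using choice[of "\<lambda>x F. hermitian F \<and> (\<forall>B. hermitian B \<longrightarrow> F \<bullet> B = a $ x \<bullet> B)"]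
      hermitian_part by blast
  have nnF: "nonneg_op (F x)" for x
  proof -
    have "0 \<le> F x \<bullet> rank_one_op v" for v
    proof -
      \<comment> \<open>The family supported on the single index \<open>x\<close> isolates the
        quadratic form of \<open>F x\<close>.\<close>
      have "axis x (rank_one_op v) \<in> C"
        by (auto simp: C_def axis_def nonneg_rank_one_op nonneg_op_0)
      then have "0 \<le> a \<bullet> axis x (rank_one_op v)" by (rule aC)
      then show ?thesis by (simp add: inner_axis F hermitian_rank_one_op)
    qed
    then show ?thesis by (simp add: nonneg_op_iff F)
  qed
  define S where "S = (\<Sum>x\<in>UNIV. F x)"
  have nnS: "nonneg_op S" unfolding S_def by (intro nonneg_op_sum nnF)
  have sep: "g * (S \<bullet> \<sigma>) < (\<Sum>x\<in>UNIV. F x \<bullet> (p x *\<^sub>R \<rho> x))" if "\<sigma> \<in> D" for \<sigma>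
  proof -
    have h: "hermitian \<sigma>" using that by (auto simp: D_def density_op_def nonneg_op_def)
    have "a \<bullet> f \<sigma> = (\<Sum>x\<in>UNIV. F x \<bullet> (g *\<^sub>R \<sigma> - p x *\<^sub>R \<rho> x))"
      using nonneg_opD(1)[OF R]
      by (subst inner_vec_def) (simp add: f_def F hermitian_diff hermitian_scaleR h)
    also have "\<dots> = g * (S \<bullet> \<sigma>) - (\<Sum>x\<in>UNIV. F x \<bullet> (p x *\<^sub>R \<rho> x))"
      by (simp add: S_def inner_diff_right sum_subtractf inner_sum_left sum_distrib_left)
    finally show ?thesis using ab(1)[OF that] b0 by simp
  qed
  have "continuous_on D (\<lambda>\<sigma>. S \<bullet> \<sigma>)" by (intro continuous_intros)
  then obtain \<sigma>0 where \<sigma>0: "\<sigma>0 \<in> D" "\<And>\<sigma>. \<sigma> \<in> D \<Longrightarrow> S \<bullet> \<sigma> \<le> S \<bullet> \<sigma>0"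
    using continuous_attains_sup[OF D(1,3)] by blast
  \<comment> \<open>The maximum of \<open>S \<bullet> \<sigma>\<close> over density operators is the
    largest eigenvalue of \<open>S\<close>; the proof of \<open>\<nu> id \<ge> S\<close> tests it on
    normalised rank-one operators.\<close>
  define \<nu> where "\<nu> = S \<bullet> \<sigma>0"
  have "0 \<le> (\<nu> *\<^sub>R mat 1 - S) \<bullet> rank_one_op v" for v
  proof (cases "v = 0")
    case True
    then show ?thesis by (simp add: rank_one_op_def zero_vec_def[symmetric])
  next
    case False
    then have "(1 / (norm v)\<^sup>2) *\<^sub>R rank_one_op v \<in> D"
      using trace_rank_one_op[of v]
      by (simp add: D_def density_op_def nonneg_op_scaleR nonneg_rank_one_op trace_def
          scaleR_sum_right[symmetric]) (simp add: scaleR_conv_of_real)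
    then have "S \<bullet> ((1 / (norm v)\<^sup>2) *\<^sub>R rank_one_op v) \<le> \<nu>"
      unfolding \<nu>_def by (rule \<sigma>0(2))
    then show ?thesis
      using False by (simp add: inner_diff_left inner_mat_1 trace_rank_one_op field_simps)
  qed
  then have dom: "nonneg_op (\<nu> *\<^sub>R mat 1 - S)"
    using nonneg_opD(1)[OF nnS]
    by (simp add: nonneg_op_iff hermitian_diff hermitian_scaleR hermitian_mat_1)
  \<comment> \<open>Any \<open>t\<close> above \<open>\<nu>\<close> also dominates \<open>S\<close>
    and is strictly positive, as the normalisation requires.\<close>
  have dom': "nonneg_op (t *\<^sub>R mat 1 - S)" if "\<nu> < t" for t
  proof -
    have "t *\<^sub>R mat 1 - S = (\<nu> *\<^sub>R mat 1 - S) + (t - \<nu>) *\<^sub>R mat 1"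
      by (simp add: algebra_simps)
    then show ?thesis
      using that by (simp only:) (intro nonneg_op_add dom nonneg_op_scaleR nonneg_mat_1; simp)
  qed
  have "0 \<le> \<nu>"
    unfolding \<nu>_def using \<sigma>0(1) by (intro inner_nonneg_op nnS) (simp add: D_def density_op_def)
  have "(\<Sum>x\<in>UNIV. F x \<bullet> (p x *\<^sub>R \<rho> x)) \<le> g * t" if "\<nu> < t" for t
    unfolding g_def using that \<open>0 \<le> \<nu>\<close> dom'[OF that]
    by (intro subnormalised_success_le nnF R) (auto simp: S_def)
  moreover \<comment> \<open>passing to the limit \<open>t \<rightarrow> \<nu>\<close> also covers \<open>\<nu> = 0\<close>, where \<open>F\<close> cannot be normalised\<close>
  have "((\<lambda>t. g * t) \<longlongrightarrow> g * \<nu>) (at_right \<nu>)"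
    by (intro tendsto_intros)
  ultimately have "(\<Sum>x\<in>UNIV. F x \<bullet> (p x *\<^sub>R \<rho> x)) \<le> g * \<nu>"
    by (intro tendsto_lowerbound) (auto simp: eventually_at_filter)
  then show False using sep[OF \<sigma>0(1)] by (simp add: \<nu>_def)
qed

section \<open>Min-entropy and guessing probability\<close>

theorem theorem1:
  fixes e :: "'x::finite \<Rightarrow> complex ^ 'n"
    and p :: "'x \<Rightarrow> real"
    and \<rho> :: "'x \<Rightarrow> complex ^ 'b ^ 'b"
  assumes "orthonormal_basis e"
    and "\<And>x. 0 \<le> p x" and "(\<Sum>x\<in>UNIV. p x) = 1"
    and "\<And>x. density_op (\<rho> x)"
  shows "H_min (cq_state e p \<rho>) = - ereal (log 2 (p_guess p \<rho>))"
proof -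
  have nn: "nonneg_op (\<rho> x)" and tr: "trace (\<rho> x) = 1" for x
    using assms(4) by (auto simp: density_op_def)
  have iff: "op_le (cq_state e p \<rho>) (c *\<^sub>R tensor_op (mat 1 :: complex ^ 'n ^ 'n) \<sigma>) \<longleftrightarrow>
      (\<forall>x. nonneg_op (c *\<^sub>R \<sigma> - p x *\<^sub>R \<rho> x))" if "density_op \<sigma>" for c \<sigma>
    using that nn by (intro cq_state_dominated_iff assms) (auto simp: density_op_def nonneg_op_def)
  obtain \<sigma> where \<sigma>: "density_op \<sigma>" "\<And>x. nonneg_op (p_guess p \<rho> *\<^sub>R \<sigma> - p x *\<^sub>R \<rho> x)"
    using dominating_density_op[of p \<rho>] nonneg_op_scaleR[OF nn assms(2)] by blast
  \<comment> \<open>Take traces in the domination by \<open>\<sigma>\<close>. Some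
    \<open>p x\<close> is positive, so \<open>p_guess\<close> is positive and its logarithm is
    meaningful.\<close>
  have "p x \<le> p_guess p \<rho>" for x
    using inner_nonneg_op[OF nonneg_mat_1 \<sigma>(2), of x] \<sigma>(1) tr[of x]
    by (simp add: inner_diff_right inner_mat_1 density_op_def)
  moreover have "\<exists>x. p x > 0"
    using assms(3) by (metis sum_nonpos not_le not_one_le_zero)
  ultimately have pos: "p_guess p \<rho> > 0"
    by (metis less_le_trans)
  have "(INF \<sigma> \<in> {\<sigma> :: complex ^ 'b ^ 'b. density_op \<sigma>}.
      D_infty (cq_state e p \<rho>) (tensor_op (mat 1 :: complex ^ 'n ^ 'n) \<sigma>)) =
      ereal (log 2 (p_guess p \<rho>))"
  proof (rule antisym)
    show "(INF \<sigma> \<in> {\<sigma> :: complex ^ 'b ^ 'b. density_op \<sigma>}.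
        D_infty (cq_state e p \<rho>) (tensor_op (mat 1 :: complex ^ 'n ^ 'n) \<sigma>)) \<le>
        ereal (log 2 (p_guess p \<rho>))"
      \<comment> \<open>The witnesses are the dominating \<open>\<sigma>\<close> and
        \<open>l = log 2 (p_guess p \<rho>)\<close>, for which \<open>2 powr l\<close> is
        \<open>p_guess p \<rho>\<close> by positivity.\<close>
      unfolding D_infty_def using \<sigma> pos by (intro INF_lower2[of \<sigma>] Inf_lower) (auto simp: iff)
    show "ereal (log 2 (p_guess p \<rho>)) \<le> (INF \<sigma> \<in> {\<sigma> :: complex ^ 'b ^ 'b. density_op \<sigma>}.
        D_infty (cq_state e p \<rho>) (tensor_op (mat 1 :: complex ^ 'n ^ 'n) \<sigma>))"
      unfolding D_infty_def
    proof (intro INF_greatest Inf_greatest, clarify)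
      fix \<sigma> :: "complex ^ 'b ^ 'b" and l
      assume "density_op \<sigma>"
        and "op_le (cq_state e p \<rho>) ((2 powr l) *\<^sub>R tensor_op (mat 1 :: complex ^ 'n ^ 'n) \<sigma>)"
      then have "p_guess p \<rho> \<le> 2 powr l"
        by (intro p_guess_le[of _ \<sigma>]) (auto simp: iff density_op_def)
      then show "ereal (log 2 (p_guess p \<rho>)) \<le> ereal l"
        using pos by (simp add: log_le_iff)
    qed
  qed
  then show ?thesis by (simp add: H_min_def)
qed

end
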